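(* Let $G$ be a graph and $R\subseteq V(G)$ an independent set of terminals with $|R|\ge 2$. Then $G$ has an $R$-CIST of size $k$ if and only if there exist pairwise disjoint subsets $V_1,\dots,V_k$ of $V(G)$ such that each $V_i$ is a connected $R$-dominating set.
   Context: Graphs are finite and connected, may have parallel edges but no loops. For a tree $T$, $\mathrm{int}(T)$ is the set of vertices of degree at least 2 in $T$ and $L(T)$ the set of leaves. An $R$-Steiner tree is a subtree $T$ with $R\subseteq V(T)$ and $L(T)\subseteq R$; $T(u,v)$ is the unique $(u,v)$-path in $T$. An $R$-CIST of size $k$ is a set $\{T_1,\dots,T_k\}$ of $R$-Steiner trees such that for all distinct $u,v\in R$ and distinct $i,j$, $T_i(u,v)$ and $T_j(u,v)$ are edge-disjoint and internally vertex-disjoint. A set $Q\subseteq V(G)$ is a connected $R$-dominating set if $G[Q]$ is connected and every vertex of $R$ lies in $Q$ or is adjacent to a vertex of $Q$. *)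

theory Defs
  imports Main "HOL-Library.Disjoint_Sets"
begin

text \<open>
  Undirected multigraphs: edges are named objects, so two edges may have the same set of ends.
  The notion of tree of the AFP entry Graph-Theory is not used, because that entry models
  undirected graphs as symmetric digraphs, in which every edge traversed back and forth
  is already a cycle.
\<close>

record ('v, 'e) mgraph =
  vertices :: "'v set"
  edges :: "'e set"
  ends :: "'e \<Rightarrow> 'v set"

text \<open>Loops are excluded by requiring exactly two ends.\<close>

definition multigraph :: "('v, 'e) mgraph \<Rightarrow> bool" where
  "multigraph G \<longleftrightarrow> finite (vertices G) \<and> finite (edges G) \<and>
     (\<forall>e\<in>edges G. ends G e \<subseteq> vertices G \<and> card (ends G e) = 2)"

definition adjacent :: "('v, 'e) mgraph \<Rightarrow> 'v \<Rightarrow> 'v \<Rightarrow> bool" where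
  "adjacent G u v \<longleftrightarrow> (\<exists>e\<in>edges G. ends G e = {u, v})"

definition independent_set :: "('v, 'e) mgraph \<Rightarrow> 'v set \<Rightarrow> bool" where
  "independent_set G R \<longleftrightarrow> R \<subseteq> vertices G \<and> (\<forall>u\<in>R. \<forall>v\<in>R. \<not> adjacent G u v)"

definition degree :: "('v, 'e) mgraph \<Rightarrow> 'v \<Rightarrow> nat" where
  "degree G v = card {e \<in> edges G. v \<in> ends G e}"

definition leaves :: "('v, 'e) mgraph \<Rightarrow> 'v set" where
  "leaves G = {v \<in> vertices G. degree G v = 1}"

definition subgraph_of :: "('v, 'e) mgraph \<Rightarrow> ('v, 'e) mgraph \<Rightarrow> bool" where
  "subgraph_of H G \<longleftrightarrow> multigraph H \<and> vertices H \<subseteq> vertices G \<and> edges H \<subseteq> edges G \<and> ends H = ends G"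

definition induced :: "('v, 'e) mgraph \<Rightarrow> 'v set \<Rightarrow> ('v, 'e) mgraph" where
  "induced G Q = \<lparr>vertices = Q, edges = {e \<in> edges G. ends G e \<subseteq> Q}, ends = ends G\<rparr>"

text \<open>
  A walk is given by its list of vertices (one more than edges) and its list of edges; the
  vertex list alone would not determine it in the presence of parallel edges.
\<close>

fun walk :: "('v, 'e) mgraph \<Rightarrow> 'v list \<times> 'e list \<Rightarrow> bool" where
  "walk G ([v], []) \<longleftrightarrow> v \<in> vertices G"
| "walk G (u # v # vs, e # es) \<longleftrightarrow>
     u \<in> vertices G \<and> e \<in> edges G \<and> ends G e = {u, v} \<and> walk G (v # vs, es)"
| "walk G _ \<longleftrightarrow> False"

definition path_between :: "('v, 'e) mgraph \<Rightarrow> 'v \<Rightarrow> 'v list \<times> 'e list \<Rightarrow> 'v \<Rightarrow> bool" where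
  "path_between G u p v \<longleftrightarrow> walk G p \<and> distinct (fst p) \<and> hd (fst p) = u \<and> last (fst p) = v"

text \<open>
  Distinctness of the edges excludes going back and forth along one edge, while two parallel
  edges form a cycle of length two.
\<close>

definition is_cycle :: "('v, 'e) mgraph \<Rightarrow> 'v list \<times> 'e list \<Rightarrow> bool" where
  "is_cycle G p \<longleftrightarrow> walk G p \<and> snd p \<noteq> [] \<and> hd (fst p) = last (fst p) \<and>
     distinct (tl (fst p)) \<and> distinct (snd p)"

definition connected_graph :: "('v, 'e) mgraph \<Rightarrow> bool" where
  "connected_graph G \<longleftrightarrow> vertices G \<noteq> {} \<and>
     (\<forall>u\<in>vertices G. \<forall>v\<in>vertices G. \<exists>p. path_between G u p v)"

definition is_tree :: "('v, 'e) mgraph \<Rightarrow> bool" where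
  "is_tree T \<longleftrightarrow> multigraph T \<and> connected_graph T \<and> (\<nexists>p. is_cycle T p)"

definition tree_path :: "('v, 'e) mgraph \<Rightarrow> 'v \<Rightarrow> 'v \<Rightarrow> 'v list \<times> 'e list" where
  "tree_path T u v = (THE p. path_between T u p v)"

definition steiner_tree :: "('v, 'e) mgraph \<Rightarrow> 'v set \<Rightarrow> ('v, 'e) mgraph \<Rightarrow> bool" where
  "steiner_tree G R T \<longleftrightarrow> subgraph_of T G \<and> is_tree T \<and> R \<subseteq> vertices T \<and> leaves T \<subseteq> R"

definition edge_disjoint :: "'v list \<times> 'e list \<Rightarrow> 'v list \<times> 'e list \<Rightarrow> bool" where
  "edge_disjoint p q \<longleftrightarrow> set (snd p) \<inter> set (snd q) = {}"

definition internal_vertices :: "'v list \<times> 'e list \<Rightarrow> 'v set" where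
  "internal_vertices p = set (butlast (tl (fst p)))"

definition internally_disjoint :: "'v list \<times> 'e list \<Rightarrow> 'v list \<times> 'e list \<Rightarrow> bool" where
  "internally_disjoint p q \<longleftrightarrow> internal_vertices p \<inter> internal_vertices q = {}"

definition CIST :: "('v, 'e) mgraph \<Rightarrow> 'v set \<Rightarrow> ('v, 'e) mgraph set \<Rightarrow> bool" where
  "CIST G R \<T> \<longleftrightarrow> (\<forall>T\<in>\<T>. steiner_tree G R T) \<and>
     (\<forall>u\<in>R. \<forall>v\<in>R. u \<noteq> v \<longrightarrow> (\<forall>T\<in>\<T>. \<forall>T'\<in>\<T>. T \<noteq> T' \<longrightarrow>
        edge_disjoint (tree_path T u v) (tree_path T' u v) \<and>
        internally_disjoint (tree_path T u v) (tree_path T' u v)))"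

definition connected_dominating :: "('v, 'e) mgraph \<Rightarrow> 'v set \<Rightarrow> 'v set \<Rightarrow> bool" where
  "connected_dominating G R Q \<longleftrightarrow> Q \<subseteq> vertices G \<and> connected_graph (induced G Q) \<and>
     (\<forall>r\<in>R. r \<in> Q \<or> (\<exists>q\<in>Q. adjacent G r q))"

end

theory Submission
  imports Defs
begin

text \<open>
  If the trees are given, take for \<open>V\<^sub>i\<close> the vertices of degree at least 2 of \<open>T\<^sub>i\<close>. A vertex
  \<open>x\<close> of degree at least 2 in a Steiner tree splits \<open>R - {x}\<close> into at least two classes, since
  every branch at \<open>x\<close> ends in a leaf. Two nontrivial partitions of the same set always
  separate a common pair \<open>u, v\<close>, so a vertex in \<open>V\<^sub>i \<inter> V\<^sub>j\<close> would be internal to both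
  \<open>T\<^sub>i(u,v)\<close> and \<open>T\<^sub>j(u,v)\<close>.

  Conversely, attach every terminal outside \<open>V\<^sub>i\<close> to \<open>G[V\<^sub>i]\<close> by a single edge and take a
  minimal connected subgraph containing \<open>R\<close>. Its internal vertices lie in \<open>V\<^sub>i\<close>, and an edge
  common to two such trees would join two terminals.
\<close>

section \<open>Walks and connectivity\<close>

text \<open>Connectivity inside \<open>S\<close> is the closure \<open>(linked G S)\<^sup>*\<close>:
  unlike paths, it composes and reverses freely and is monotone. With
  \<open>S = vertices G - {x}\<close> its classes on \<open>S\<close> are the components left after
  removing \<open>x\<close>.\<close>

definition linked :: "('v, 'e) mgraph \<Rightarrow> 'v set \<Rightarrow> ('v \<times> 'v) set" where
  "linked G S = {(u, v). u \<in> S \<and> v \<in> S \<and> adjacent G u v}"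

lemma adjacent_sym: "adjacent G u v \<Longrightarrow> adjacent G v u"
  by (auto simp: adjacent_def insert_commute)

lemma linked_rtrancl_sym: "(u, v) \<in> (linked G S)\<^sup>* \<Longrightarrow> (v, u) \<in> (linked G S)\<^sup>*"
proof -
  have "sym (linked G S)"
    by (auto simp: linked_def sym_def intro: adjacent_sym)
  then show "(u, v) \<in> (linked G S)\<^sup>* \<Longrightarrow> (v, u) \<in> (linked G S)\<^sup>*"
    by (meson sym_rtrancl symD)
qed

lemma linked_rtrancl_in: "(u, v) \<in> (linked G S)\<^sup>* \<Longrightarrow> u \<in> S \<Longrightarrow> v \<in> S"
  by (induction rule: rtrancl_induct) (auto simp: linked_def)

lemma walk_ne: "walk G (vs, es) \<Longrightarrow> vs \<noteq> []"
  by (cases vs) auto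

lemma walk_vertices: "walk G (vs, es) \<Longrightarrow> set vs \<subseteq> vertices G"
  by (induction G "(vs, es)" arbitrary: vs es rule: walk.induct) auto

lemma walk_edges: "walk G (vs, es) \<Longrightarrow> set es \<subseteq> edges G"
  by (induction G "(vs, es)" arbitrary: vs es rule: walk.induct) auto

lemma walk_ends: "walk G (vs, es) \<Longrightarrow> e \<in> set es \<Longrightarrow> ends G e \<subseteq> set vs"
  by (induction G "(vs, es)" arbitrary: vs es rule: walk.induct) auto

text \<open>Were the first edge used again, its first end would reappear among the later
  vertices.\<close>

lemma walk_distinct_edges: "walk G (vs, es) \<Longrightarrow> distinct vs \<Longrightarrow> distinct es"
proof (induction G "(vs, es)" arbitrary: vs es rule: walk.induct)
  case (2 G u v vs e es)
  then have "e \<notin> set es"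
    using walk_ends[of G "v # vs" es e] by auto
  with 2 show ?case by auto
qed auto

lemma walk_linked:
  "walk G (vs, es) \<Longrightarrow> set vs \<subseteq> S \<Longrightarrow> (hd vs, last vs) \<in> (linked G S)\<^sup>*"
proof (induction G "(vs, es)" arbitrary: vs es rule: walk.induct)
  case (2 G u v vs e es)
  then have "(u, v) \<in> linked G S"
    by (auto simp: linked_def adjacent_def)
  with 2 show ?case
    by (auto intro: converse_rtrancl_into_rtrancl)
qed auto

lemma walk_snoc:
  "walk G (vs, es) \<Longrightarrow> f \<in> edges G \<Longrightarrow> ends G f = {last vs, y} \<Longrightarrow> y \<in> vertices G \<Longrightarrow>
    walk G (vs @ [y], es @ [f])"
  by (induction G "(vs, es)" arbitrary: vs es rule: walk.induct) auto

lemma walk_suffix: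
  "walk G (vs, es) \<Longrightarrow> x \<in> set vs \<Longrightarrow> distinct vs \<Longrightarrow>
    \<exists>ws fs. walk G (ws, fs) \<and> hd ws = x \<and> last ws = last vs \<and> set ws \<subseteq> set vs \<and> distinct ws"
proof (induction G "(vs, es)" arbitrary: vs es rule: walk.induct)
  case (1 G v)
  then show ?case by (intro exI[of _ "[v]"] exI[of _ "[]"]) auto
next
  case (2 G u v vs e es)
  show ?case
  proof (cases "x = u")
    case True
    with 2 show ?thesis
      by (intro exI[of _ "u # v # vs"] exI[of _ "e # es"]) auto
  next
    case False
    with 2 obtain ws fs where "walk G (ws, fs)" "hd ws = x" "last ws = last (v # vs)"
      "set ws \<subseteq> set (v # vs)" "distinct ws"
      by auto
    then show ?thesis by (intro exI[of _ ws] exI[of _ fs]) auto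
  qed
qed auto

text \<open>Vertices are prepended one at a time. If the new vertex already lies on the path, the
  suffix starting there is taken instead, which keeps the vertices distinct.\<close>

lemma linked_path:
  assumes "(u, v) \<in> (linked G S)\<^sup>*" "u \<in> S" "S \<subseteq> vertices G"
  shows "\<exists>p. path_between G u p v \<and> set (fst p) \<subseteq> S"
  using assms(1,2)
proof (induction rule: converse_rtrancl_induct)
  case base
  with assms(3) show ?case
    by (intro exI[of _ "([v], [])"]) (auto simp: path_between_def)
next
  case (step u y)
  then obtain vs es where p: "walk G (vs, es)" "distinct vs" "hd vs = y" "last vs = v" "set vs \<subseteq> S"
    by (force simp: path_between_def linked_def)
  show ?case
  proof (cases "u \<in> set vs")
    case True
    from walk_suffix[OF p(1) this p(2)] p show ?thesis
      by (force simp: path_between_def)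
  next
    case False
    obtain ws where "vs = y # ws" using p(3) walk_ne[OF p(1)] by (cases vs) auto
    moreover obtain e where "e \<in> edges G" "ends G e = {u, y}"
      using step(1) by (auto simp: linked_def adjacent_def)
    ultimately show ?thesis
      using p False step assms(3)
      by (intro exI[of _ "(u # vs, e # es)"]) (auto simp: path_between_def)
  qed
qed

lemma path_linked:
  "path_between G u p v \<Longrightarrow> set (fst p) \<subseteq> S \<Longrightarrow> (u, v) \<in> (linked G S)\<^sup>*"
  using walk_linked[of G "fst p" "snd p" S] by (auto simp: path_between_def)

text \<open>Reduces connectivity proofs to inclusions between \<open>linked\<close> relations, with
  no paths to construct.\<close>

lemma connected_graph_iff_linked:
  "connected_graph G \<longleftrightarrow> vertices G \<noteq> {} \<and>
    (\<forall>u\<in>vertices G. \<forall>v\<in>vertices G. (u, v) \<in> (linked G (vertices G))\<^sup>*)"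
proof -
  have "set (fst p) \<subseteq> vertices G" if "path_between G u p v" for u v p
    using walk_vertices[of G "fst p" "snd p"] that by (auto simp: path_between_def)
  then show ?thesis
    unfolding connected_graph_def by (meson linked_path path_linked order_refl)
qed

section \<open>Interior vertices of paths and vertices of degree at least 2\<close>

lemma internal_vertices_path:
  assumes "path_between G u p v" "u \<noteq> v"
  shows "internal_vertices p = set (fst p) - {u, v}"
proof -
  obtain vs es where p: "p = (vs, es)" by (cases p)
  with assms have d: "distinct vs" "hd vs = u" "last vs = v" "vs \<noteq> []"
    using walk_ne by (auto simp: path_between_def)
  then obtain ws where ws: "vs = u # ws" by (cases vs) auto
  with d assms have "ws = butlast ws @ [v]" by (metis append_butlast_last_id last.simps)
  then obtain xs where "vs = u # xs @ [v]" using ws by metis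
  with d show ?thesis by (auto simp: internal_vertices_def p)
qed

text \<open>The two edges are those by which the path enters and leaves \<open>x\<close>.\<close>

lemma path_interior_edges:
  assumes "walk G (vs, es)" "distinct vs" "x \<in> set vs" "x \<noteq> hd vs" "x \<noteq> last vs"
  shows "\<exists>e\<in>edges G. \<exists>f\<in>edges G. e \<noteq> f \<and> x \<in> ends G e \<and> x \<in> ends G f"
  using assms
proof (induction G "(vs, es)" arbitrary: vs es rule: walk.induct)
  case (2 G u v vs e es)
  show ?case
  proof (cases "x = v")
    case True
    with 2 obtain w ws where vs: "vs = w # ws" by (cases vs) auto
    with 2 obtain f fs where es: "es = f # fs" by (cases es) auto
    \<comment> \<open>\<open>u\<close> is an end of \<open>e\<close>, but both ends of
      \<open>f\<close> lie in \<open>v # vs\<close>, where \<open>u\<close> does not occur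
      again.\<close>
    have "e \<noteq> f" using 2 vs es by auto
    with 2 vs es True show ?thesis by auto
  next
    case False
    with 2 show ?thesis by auto
  qed
qed auto

lemma degree_ge_2_iff:
  assumes "multigraph G"
  shows "degree G x \<ge> 2 \<longleftrightarrow>
    (\<exists>e\<in>edges G. \<exists>f\<in>edges G. e \<noteq> f \<and> x \<in> ends G e \<and> x \<in> ends G f)"
proof -
  have "finite {e \<in> edges G. x \<in> ends G e}"
    using assms by (auto simp: multigraph_def)
  then have "degree G x \<le> Suc 0 \<longleftrightarrow> (\<forall>e\<in>{e \<in> edges G. x \<in> ends G e}.
      \<forall>f\<in>{e \<in> edges G. x \<in> ends G e}. e = f)"
    unfolding degree_def by (rule card_le_Suc0_iff_eq)
  moreover have "degree G x \<ge> 2 \<longleftrightarrow> \<not> degree G x \<le> Suc 0" by linarith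
  ultimately show ?thesis by blast
qed

text \<open>This is int(T). The vertex of a one-vertex tree has degree 0 and is neither inner nor a
  leaf.\<close>

definition inner_vertices :: "('v, 'e) mgraph \<Rightarrow> 'v set" where
  "inner_vertices G = {v \<in> vertices G. degree G v \<ge> 2}"

lemma path_inner:
  assumes "multigraph G" "path_between G u p v" "x \<in> set (fst p)" "x \<noteq> u" "x \<noteq> v"
  shows "x \<in> inner_vertices G"
  using assms path_interior_edges[of G "fst p" "snd p" x] walk_vertices[of G "fst p" "snd p"]
  by (auto simp: path_between_def inner_vertices_def degree_ge_2_iff)

section \<open>Acyclic graphs\<close>

lemma multigraph_edge:
  assumes "multigraph G" "e \<in> edges G" "ends G e = {a, b}"
  shows "a \<noteq> b" "a \<in> vertices G" "b \<in> vertices G"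
  using assms by (auto simp: multigraph_def)

lemma multigraph_edge_other:
  assumes "multigraph G" "e \<in> edges G" "x \<in> ends G e"
  obtains a where "ends G e = {x, a}"
proof -
  obtain y z where "ends G e = {y, z}"
    using assms by (auto simp: multigraph_def card_2_iff)
  then have "ends G e = {x, z} \<or> ends G e = {x, y}" using assms(3) by auto
  then show ?thesis using that by blast
qed

text \<open>A path from \<open>a\<close> to \<open>b\<close> off \<open>x\<close> closes up with
  \<open>e\<close> and \<open>f\<close> to a cycle through \<open>x\<close>. For
  \<open>a = b\<close> this is the cycle of two parallel edges.\<close>

lemma branches_separated:
  assumes "multigraph G" "\<nexists>p. is_cycle G p"
    and "e \<in> edges G" "f \<in> edges G" "e \<noteq> f" "ends G e = {x, a}" "ends G f = {x, b}"
  shows "(a, b) \<notin> (linked G (vertices G - {x}))\<^sup>*"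
proof
  assume "(a, b) \<in> (linked G (vertices G - {x}))\<^sup>*"
  with multigraph_edge[OF assms(1,3,6)] obtain vs es where
    p: "walk G (vs, es)" "distinct vs" "hd vs = a" "last vs = b" "x \<notin> set vs"
    using linked_path[of a b G "vertices G - {x}"] by (force simp: path_between_def)
  have "walk G (vs @ [x], es @ [f])"
    using p assms multigraph_edge[OF assms(1,3,6)] by (intro walk_snoc) auto
  moreover obtain ws where "vs = a # ws" using p(3) walk_ne[OF p(1)] by (cases vs) auto
  \<comment> \<open>All ends of edges of the path lie on the path, which misses
    \<open>x\<close>.\<close>
  moreover have "e \<notin> set es" "f \<notin> set es"
    using walk_ends[OF p(1)] p(5) assms by blast+
  ultimately have "is_cycle G (x # vs @ [x], e # es @ [f])"
    using assms p multigraph_edge[OF assms(1,3,6)] walk_distinct_edges[OF p(1,2)]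
    by (auto simp: is_cycle_def)
  with assms(2) show False by blast
qed

text \<open>Two paths with the same ends must start with the same edge, since otherwise their
  remainders would link two different branches at the first vertex. Induction treats the
  remainders.\<close>

lemma acyclic_path_unique:
  assumes "multigraph G" "\<nexists>p. is_cycle G p"
    and "walk G (vs, es)" "walk G (ws, fs)" "distinct vs" "distinct ws"
    and "hd vs = hd ws" "last vs = last ws"
  shows "(vs, es) = (ws, fs)"
  using assms
proof (induction G "(vs, es)" arbitrary: vs es ws fs rule: walk.induct)
  case (1 G v)
  have "ws \<noteq> []" using walk_ne 1 by blast
  with 1 have "ws = [v]"
    by (cases ws) (auto split: if_splits)
  with 1 show ?case by (cases fs) auto
next
  case (2 G u v vs e es)
  obtain w ws' where ws: "ws = u # w # ws'"
    using 2 walk_ne[of G ws fs] by (cases ws; cases "tl ws") (auto split: if_splits)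
  obtain f fs' where fs: "fs = f # fs'" using 2 ws by (cases fs) auto
  have "e = f"
  proof (rule ccontr)
    assume "e \<noteq> f"
    \<comment> \<open>Both remainders avoid \<open>u\<close> and stop at the same vertex, so
      together they link \<open>v\<close> to \<open>w\<close> off \<open>u\<close>.\<close>
    let ?S = "vertices G - {u}"
    have "walk G (v # vs, es)" "set (v # vs) \<subseteq> ?S"
      using walk_vertices[of G "v # vs" es] 2 by auto
    from walk_linked[OF this] have "(v, last (v # vs)) \<in> (linked G ?S)\<^sup>*"
      by (simp only: list.sel)
    moreover have "walk G (w # ws', fs')" "set (w # ws') \<subseteq> ?S"
      using walk_vertices[of G "w # ws'" fs'] 2 ws fs by auto
    from walk_linked[OF this] have "(w, last (w # ws')) \<in> (linked G ?S)\<^sup>*"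
      by (simp only: list.sel)
    moreover have "last (v # vs) = last (w # ws')" using 2 ws by auto
    ultimately have "(v, w) \<in> (linked G ?S)\<^sup>*"
      by (metis linked_rtrancl_sym rtrancl_trans)
    moreover have "e \<in> edges G" "f \<in> edges G" "ends G e = {u, v}" "ends G f = {u, w}"
      using 2 ws fs by auto
    ultimately show False
      using branches_separated 2(2,3) \<open>e \<noteq> f\<close> by metis
  qed
  moreover from this have "v = w" using 2 ws fs by (auto simp: doubleton_eq_iff)
  moreover have "(v # vs, es) = (w # ws', fs')"
    using 2 ws fs \<open>v = w\<close> by (intro "2.hyps") auto
  ultimately show ?case using ws fs by auto
qed auto

lemma tree_path_eq:
  assumes "is_tree T" "path_between T u p v"
  shows "tree_path T u v = p"
  unfolding tree_path_def
proof (rule the_equality)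
  show "q = p" if "path_between T u q v" for q
    using acyclic_path_unique[of T "fst q" "snd q" "fst p" "snd p"] assms that
    by (auto simp: is_tree_def path_between_def prod_eq_iff)
qed fact

lemma tree_path_between:
  assumes "is_tree T" "u \<in> vertices T" "v \<in> vertices T"
  shows "path_between T u (tree_path T u v) v"
  using assms tree_path_eq[OF assms(1)] unfolding is_tree_def connected_graph_def by metis

text \<open>Induction on the size of the branch of \<open>a\<close> seen from \<open>x\<close>. If
  \<open>a\<close> is not a leaf, a second edge at \<open>a\<close> leads to some \<open>b\<close>
  whose branch seen from \<open>a\<close> is strictly smaller.\<close>

lemma branch_contains_leaf:
  assumes "multigraph G" "\<nexists>p. is_cycle G p" "e \<in> edges G" "ends G e = {x, a}"
  shows "\<exists>l\<in>leaves G. (a, l) \<in> (linked G (vertices G - {x}))\<^sup>*"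
  using assms(3,4)
proof (induction "card {y. (a, y) \<in> (linked G (vertices G - {x}))\<^sup>*}"
    arbitrary: x a e rule: less_induct)
  case less
  note ax = multigraph_edge[OF assms(1) less(2,3)]
  let ?C = "\<lambda>a x. {y. (a, y) \<in> (linked G (vertices G - {x}))\<^sup>*}"
  show ?case
  proof (cases "a \<in> leaves G")
    case False
    have fin: "finite {e \<in> edges G. a \<in> ends G e}" "e \<in> {e \<in> edges G. a \<in> ends G e}"
      using assms(1) less by (auto simp: multigraph_def)
    then have "degree G a \<noteq> 0" "degree G a \<noteq> 1"
      using False ax by (auto simp: degree_def leaves_def)
    then have "degree G a \<ge> 2" by linarith
    then obtain f where f: "f \<in> edges G" "f \<noteq> e" "a \<in> ends G f"
      using degree_ge_2_iff[OF assms(1)] by metis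
    then obtain b where b: "ends G f = {a, b}"
      using multigraph_edge_other assms(1) by metis
    note ab = multigraph_edge[OF assms(1) f(1) b]
    \<comment> \<open>\<open>b\<close> and \<open>x\<close> hang on the distinct edges
      \<open>f\<close> and \<open>e\<close> at \<open>a\<close>.\<close>
    have xb: "x \<notin> ?C b a"
      using branches_separated[OF assms(1,2) f(1) less(2) f(2) b] less(3)
      by (auto simp: insert_commute)
    then have "b \<noteq> x" by auto
    then have ab': "(a, b) \<in> linked G (vertices G - {x})"
      using ax ab f b by (auto simp: linked_def adjacent_def)
    \<comment> \<open>As \<open>x\<close> cannot be reached from \<open>b\<close> without
      \<open>a\<close>, a walk from \<open>b\<close> avoiding \<open>a\<close> also avoids
      \<open>x\<close>. Hence the branch of \<open>b\<close> is contained in that of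
      \<open>a\<close>.\<close>
    have "(b, y) \<in> (linked G (vertices G - {x}))\<^sup>* \<and> y \<noteq> x"
      if "(b, y) \<in> (linked G (vertices G - {a}))\<^sup>*" for y
      using that
    proof (induction rule: rtrancl_induct)
      case base
      show ?case using \<open>b \<noteq> x\<close> by simp
    next
      case (step y z)
      then have "z \<noteq> x" using xb by (auto dest: rtrancl_into_rtrancl)
      with step have "(y, z) \<in> linked G (vertices G - {x})"
        by (auto simp: linked_def)
      with step \<open>z \<noteq> x\<close> show ?case by (auto dest: rtrancl_into_rtrancl)
    qed
    then have sub: "?C b a \<subseteq> ?C a x"
      using ab' by (auto intro: converse_rtrancl_into_rtrancl)
    \<comment> \<open>The inclusion is strict because \<open>a\<close> belongs to its own
      branch.\<close>
    moreover have "a \<notin> ?C b a"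
      using linked_rtrancl_in[of b a G "vertices G - {a}"] ab by auto
    ultimately have "?C b a \<subset> ?C a x" by blast
    moreover have "finite (?C a x)"
      by (rule finite_subset[of _ "vertices G"])
        (use assms(1) ax linked_rtrancl_in[of a _ G "vertices G - {x}"] in
          \<open>auto simp: multigraph_def\<close>)
    ultimately have "card (?C b a) < card (?C a x)" by (simp add: psubset_card_mono)
    from less(1)[OF this f(1) b] sub show ?thesis by blast
  qed auto
qed

section \<open>From trees to connected dominating sets\<close>

text \<open>Two edges at \<open>x\<close> open two distinct branches, each with a leaf, and leaves
  of a Steiner tree are terminals. The vertex \<open>x\<close> may itself be a terminal, hence
  \<open>R - {x}\<close>.\<close>

lemma inner_vertex_separates:
  assumes T: "steiner_tree G R T" and x: "x \<in> inner_vertices T"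
  obtains r s where "r \<in> R - {x}" "s \<in> R - {x}" "(r, s) \<notin> (linked T (vertices T - {x}))\<^sup>*"
proof -
  let ?L = "linked T (vertices T - {x})"
  have t: "multigraph T" "\<nexists>p. is_cycle T p" "leaves T \<subseteq> R"
    using T by (auto simp: steiner_tree_def is_tree_def)
  obtain e f where ef: "e \<in> edges T" "f \<in> edges T" "e \<noteq> f" "x \<in> ends T e" "x \<in> ends T f"
    using x degree_ge_2_iff[OF t(1)] by (auto simp: inner_vertices_def)
  then obtain a b where ab: "ends T e = {x, a}" "ends T f = {x, b}"
    using multigraph_edge_other[OF t(1)] by metis
  obtain r where r: "r \<in> R" "(a, r) \<in> ?L\<^sup>*"
    using branch_contains_leaf[OF t(1,2) ef(1) ab(1)] t(3) by auto
  obtain s where s: "s \<in> R" "(b, s) \<in> ?L\<^sup>*"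
    using branch_contains_leaf[OF t(1,2) ef(2) ab(2)] t(3) by auto
  have "r \<noteq> x" "s \<noteq> x"
    using r s linked_rtrancl_in[of _ _ T "vertices T - {x}"]
      multigraph_edge[OF t(1) ef(1) ab(1)] multigraph_edge[OF t(1) ef(2) ab(2)] by blast+
  moreover have "(r, s) \<notin> ?L\<^sup>*"
    using branches_separated[OF t(1,2) ef(1-3) ab] r s
    by (meson linked_rtrancl_sym rtrancl_trans)
  ultimately show ?thesis using that r s by blast
qed

text \<open>A tree path missing \<open>x\<close> would link its ends off \<open>x\<close>.\<close>

lemma separated_internal:
  assumes T: "steiner_tree G R T" and uv: "u \<in> R - {x}" "v \<in> R - {x}"
    and sep: "(u, v) \<notin> (linked T (vertices T - {x}))\<^sup>*"
  shows "x \<in> internal_vertices (tree_path T u v)"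
proof -
  have p: "path_between T u (tree_path T u v) v"
    using T uv by (intro tree_path_between) (auto simp: steiner_tree_def)
  have "set (fst (tree_path T u v)) \<subseteq> vertices T"
    using p walk_vertices[of T "fst (tree_path T u v)" "snd (tree_path T u v)"]
    by (auto simp: path_between_def)
  then have "x \<in> set (fst (tree_path T u v))"
    using path_linked[OF p, of "vertices T - {x}"] sep by blast
  moreover have "u \<noteq> v" using sep by auto
  ultimately show ?thesis
    using internal_vertices_path[OF p] uv by auto
qed

text \<open>For a common inner vertex \<open>x\<close>, being linked off \<open>x\<close> in
  \<open>T\<close> and in \<open>T'\<close> gives two equivalence relations on
  \<open>R - {x}\<close>, each with more than one class. Some pair is inequivalent under both, and
  \<open>x\<close> is interior to both tree paths of that pair.\<close>

lemma CIST_inner_disjoint: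
  fixes G :: "('v, 'e) mgraph"
  assumes C: "CIST G R \<T>" and "T \<in> \<T>" "T' \<in> \<T>" "T \<noteq> T'"
  shows "inner_vertices T \<inter> inner_vertices T' = {}"
proof (rule ccontr)
  assume "inner_vertices T \<inter> inner_vertices T' \<noteq> {}"
  then obtain x where x: "x \<in> inner_vertices T" "x \<in> inner_vertices T'" by auto
  have st: "steiner_tree G R T" "steiner_tree G R T'"
    using assms by (auto simp: CIST_def)
  let ?c = "\<lambda>T u v. (u, v) \<in> (linked T (vertices T - {x}))\<^sup>*"
  have tr: "?c T u w" if "?c T u v" "?c T v w" for T :: "('v, 'e) mgraph" and u v w
    using that by (rule rtrancl_trans)
  have sy: "?c T v u" if "?c T u v" for T :: "('v, 'e) mgraph" and u v
    using that by (rule linked_rtrancl_sym)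
  obtain r s where rs: "r \<in> R - {x}" "s \<in> R - {x}" "\<not> ?c T r s"
    using inner_vertex_separates[OF st(1) x(1)] by blast
  obtain r' s' where rs': "r' \<in> R - {x}" "s' \<in> R - {x}" "\<not> ?c T' r' s'"
    using inner_vertex_separates[OF st(2) x(2)] by blast
  have "\<exists>u\<in>R - {x}. \<exists>v\<in>R - {x}. \<not> ?c T u v \<and> \<not> ?c T' u v"
  proof (cases "?c T' r s")
    case True
    \<comment> \<open>The \<open>T'\<close>-class of \<open>r\<close> is not all of
      \<open>R - {x}\<close>; pick \<open>t\<close> outside it. Since \<open>s\<close> is in that
      class, \<open>T'\<close> separates \<open>t\<close> from both \<open>r\<close> and
      \<open>s\<close>, while \<open>T\<close> separates \<open>t\<close> from at least one of
      them.\<close>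
    obtain t where t: "t \<in> R - {x}" "\<not> ?c T' t r"
      using rs' tr[of r' r T' s'] sy[of s' r T'] by blast
    then have "\<not> ?c T' t s" using tr[of t s T' r] sy[OF True] by blast
    moreover have "\<not> ?c T t r \<or> \<not> ?c T t s" using rs tr[of r t T s] sy[of t r T] by blast
    ultimately show ?thesis using t rs by blast
  qed (use rs in blast)
  then obtain u v where uv: "u \<in> R - {x}" "v \<in> R - {x}" "\<not> ?c T u v" "\<not> ?c T' u v" by blast
  then have "x \<in> internal_vertices (tree_path T u v) \<inter> internal_vertices (tree_path T' u v)"
    using separated_internal[OF st(1)] separated_internal[OF st(2)] by blast
  moreover have "u \<noteq> v" using uv by auto
  then have "internally_disjoint (tree_path T u v) (tree_path T' u v)"
    using C assms(2-4) uv(1,2) unfolding CIST_def by blast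
  ultimately show False unfolding internally_disjoint_def by blast
qed

lemma card_ge_2_other:
  assumes "card A \<ge> 2"
  obtains y where "y \<in> A" "y \<noteq> x"
proof -
  have "\<not> A \<subseteq> {x}" using card_mono[of "{x}" A] assms by auto
  then show ?thesis using that by blast
qed

lemma subgraph_adjacent: "subgraph_of H G \<Longrightarrow> adjacent H u v \<Longrightarrow> adjacent G u v"
  by (auto simp: subgraph_of_def adjacent_def)

text \<open>A terminal is dominated by the next vertex on its tree path to another terminal. The
  inner vertices are connected because a tree path between two of them has only inner
  vertices.\<close>

lemma steiner_tree_inner_dominating:
  assumes "independent_set G R" "card R \<ge> 2" and T: "steiner_tree G R T"
  shows "connected_dominating G R (inner_vertices T)"
proof -
  let ?I = "inner_vertices T"
  have t: "multigraph T" "is_tree T" "subgraph_of T G" "R \<subseteq> vertices T"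
    using T by (auto simp: steiner_tree_def is_tree_def)
  have dom: "\<exists>q\<in>?I. adjacent G r q" if "r \<in> R" for r
  proof -
    obtain s where s: "s \<in> R" "s \<noteq> r"
      by (rule card_ge_2_other[OF assms(2)])
    have "path_between T r (tree_path T r s) s"
      using t(4) that s(1) by (intro tree_path_between[OF t(2)]) blast+
    moreover obtain vs es where "tree_path T r s = (vs, es)" by (rule prod.exhaust)
    ultimately have p: "path_between T r (vs, es) s" by simp
    then have w: "walk T (vs, es)" "hd vs = r" "last vs = s"
      by (auto simp: path_between_def)
    obtain ws' where "vs = r # ws'" using w(2) walk_ne[OF w(1)] by (cases vs) auto
    moreover from this obtain q ws where "ws' = q # ws" using w(3) s by (cases ws') auto
    moreover from calculation obtain e fs where "es = e # fs" using w(1) by (cases es) auto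
    ultimately have q: "vs = r # q # ws" "es = e # fs" by simp_all
    have adj: "adjacent G r q"
      using p q subgraph_adjacent[OF t(3), of r q] by (auto simp: path_between_def adjacent_def)
    \<comment> \<open>Independence of \<open>R\<close> enters here: \<open>q = s\<close> would make
      two terminals adjacent.\<close>
    then have "q \<noteq> s" using assms(1) that s by (auto simp: independent_set_def)
    moreover have "q \<noteq> r" using p q by (auto simp: path_between_def)
    ultimately have "q \<in> ?I" using path_inner[OF t(1) p, of q] q by auto
    with adj show ?thesis by blast
  qed
  have "R \<noteq> {}" using assms(2) by auto
  then have "?I \<noteq> {}" using dom by blast
  moreover have "(u, v) \<in> (linked (induced G ?I) ?I)\<^sup>*" if "u \<in> ?I" "v \<in> ?I" for u v
  proof -
    have p: "path_between T u (tree_path T u v) v"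
      using that by (intro tree_path_between[OF t(2)]) (auto simp: inner_vertices_def)
    then have "set (fst (tree_path T u v)) \<subseteq> ?I"
      using path_inner[OF t(1) p] that by blast
    then have "(u, v) \<in> (linked T ?I)\<^sup>*" by (rule path_linked[OF p])
    moreover have "linked T ?I \<subseteq> linked (induced G ?I) ?I"
      using t(3) by (fastforce simp: linked_def induced_def adjacent_def subgraph_of_def)
    ultimately show ?thesis using rtrancl_mono by blast
  qed
  ultimately have "connected_graph (induced G ?I)"
    by (auto simp: connected_graph_iff_linked induced_def)
  moreover have "?I \<subseteq> vertices G"
    using t(3) by (auto simp: inner_vertices_def subgraph_of_def)
  ultimately show ?thesis
    using dom by (auto simp: connected_dominating_def)
qed

section \<open>From connected dominating sets to trees\<close>

lemma subgraph_of_trans: "subgraph_of F H \<Longrightarrow> subgraph_of H G \<Longrightarrow> subgraph_of F G"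
  by (auto simp: subgraph_of_def)

lemma subgraph_degree_le:
  assumes "subgraph_of H G" "multigraph G"
  shows "degree H v \<le> degree G v"
  unfolding degree_def using assms
  by (intro card_mono) (auto simp: subgraph_of_def multigraph_def)

text \<open>The deleted edge is the first of the cycle; the rest of the cycle still links its
  ends.\<close>

lemma connected_delete_cycle_edge:
  assumes "connected_graph H" "is_cycle H p"
  obtains e where "e \<in> edges H" "connected_graph (H\<lparr>edges := edges H - {e}\<rparr>)"
proof -
  obtain vs e es where p: "p = (vs, e # es)"
    using assms(2) by (cases p; cases "snd p") (auto simp: is_cycle_def)
  then obtain x y ws where vs: "vs = x # y # ws"
    using assms(2) by (cases vs; cases "tl vs") (auto simp: is_cycle_def)
  let ?H = "H\<lparr>edges := edges H - {e}\<rparr>"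
  have c: "walk H (y # ws, es)" "e \<in> edges H" "ends H e = {x, y}" "e \<notin> set es" "last (y # ws) = x"
    using assms(2) p vs by (auto simp: is_cycle_def)
  have w: "walk ?H (zs, fs)" if "walk H (zs, fs)" "e \<notin> set fs" for zs fs
    using that by (induction H "(zs, fs)" arbitrary: zs fs rule: walk.induct) auto
  have yx: "(y, x) \<in> (linked ?H (vertices H))\<^sup>*"
    using walk_linked[OF w[OF c(1,4)], of "vertices H"] walk_vertices[OF c(1)] c(5) by auto
  \<comment> \<open>Each step along \<open>e\<close> is replaced by the detour \<open>yx\<close> or
    its reverse.\<close>
  have "linked H (vertices H) \<subseteq> (linked ?H (vertices H))\<^sup>*"
  proof clarify
    fix u v assume uv: "(u, v) \<in> linked H (vertices H)"
    then obtain f where f: "f \<in> edges H" "ends H f = {u, v}" "u \<in> vertices H" "v \<in> vertices H"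
      by (auto simp: linked_def adjacent_def)
    show "(u, v) \<in> (linked ?H (vertices H))\<^sup>*"
    proof (cases "f = e")
      case True
      then have "(u, v) = (x, y) \<or> (u, v) = (y, x)" using f c by (auto simp: doubleton_eq_iff)
      then show ?thesis using yx linked_rtrancl_sym[OF yx] by auto
    next
      case False
      then have "(u, v) \<in> linked ?H (vertices H)"
        using f by (auto simp: linked_def adjacent_def)
      then show ?thesis by auto
    qed
  qed
  then have "(linked H (vertices H))\<^sup>* \<subseteq> (linked ?H (vertices H))\<^sup>*"
    by (simp add: rtrancl_subset_rtrancl)
  then have "connected_graph ?H"
    using assms(1) by (auto simp: connected_graph_iff_linked)
  with c show ?thesis using that by blast
qed

definition delete_vertex :: "('v, 'e) mgraph \<Rightarrow> 'v \<Rightarrow> ('v, 'e) mgraph" where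
  "delete_vertex G v = induced G (vertices G - {v})"

text \<open>A leaf has degree 1, so it is never interior to a path between other vertices.\<close>

lemma connected_delete_leaf:
  assumes "multigraph H" "connected_graph H" "l \<in> leaves H" "vertices H - {l} \<noteq> {}"
  shows "connected_graph (delete_vertex H l)"
proof -
  let ?S = "vertices H - {l}"
  have "(u, v) \<in> (linked (delete_vertex H l) ?S)\<^sup>*" if uv: "u \<in> ?S" "v \<in> ?S" for u v
  proof -
    obtain p where p: "path_between H u p v"
      using assms(2) uv unfolding connected_graph_def by blast
    have "l \<notin> set (fst p)"
      using path_inner[OF assms(1) p, of l] uv assms(3) by (auto simp: inner_vertices_def leaves_def)
    moreover have "set (fst p) \<subseteq> vertices H"
      using p walk_vertices[of H "fst p" "snd p"] by (auto simp: path_between_def)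
    ultimately have "(u, v) \<in> (linked H ?S)\<^sup>*" using path_linked[OF p, of ?S] by blast
    moreover have "linked H ?S \<subseteq> linked (delete_vertex H l) ?S"
      by (fastforce simp: linked_def delete_vertex_def induced_def adjacent_def)
    ultimately show ?thesis using rtrancl_mono by blast
  qed
  with assms(4) show ?thesis
    by (auto simp: connected_graph_iff_linked delete_vertex_def induced_def)
qed

text \<open>In a smallest connected subgraph containing \<open>R\<close>, a cycle edge or a leaf
  outside \<open>R\<close> could still be removed.\<close>

lemma steiner_tree_exists:
  assumes "multigraph G" "connected_graph G" "R \<subseteq> vertices G" "R \<noteq> {}"
  shows "\<exists>T. steiner_tree G R T"
proof -
  let ?P = "\<lambda>H. subgraph_of H G \<and> connected_graph H \<and> R \<subseteq> vertices H"
  \<comment> \<open>Counting vertices and edges together makes both kinds of deletion decrease the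
    measure.\<close>
  let ?m = "\<lambda>H. card (vertices H) + card (edges H)"
  have "?P G" using assms by (auto simp: subgraph_of_def)
  then obtain T where T: "?P T" and min: "\<And>H. ?P H \<Longrightarrow> ?m T \<le> ?m H"
    using ex_has_least_nat[of ?P G ?m] by blast
  have "multigraph T" using T by (simp add: subgraph_of_def)
  then have mg: "multigraph T" "finite (vertices T)" "finite (edges T)"
    by (simp_all add: multigraph_def)
  have "\<not> is_cycle T p" for p
  proof
    assume "is_cycle T p"
    then obtain e where e: "e \<in> edges T" "connected_graph (T\<lparr>edges := edges T - {e}\<rparr>)"
      using connected_delete_cycle_edge T by blast
    have "multigraph (T\<lparr>edges := edges T - {e}\<rparr>)"
      using mg by (simp add: multigraph_def)
    then have "?P (T\<lparr>edges := edges T - {e}\<rparr>)"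
      using T e by (auto simp: subgraph_of_def)
    from min[OF this] show False
      using e mg card_Diff1_less[of "edges T" e] by simp
  qed
  moreover have "leaves T \<subseteq> R"
  proof (rule ccontr)
    assume "\<not> leaves T \<subseteq> R"
    then obtain l where l: "l \<in> leaves T" "l \<notin> R" by auto
    have "connected_graph (delete_vertex T l)"
      \<comment> \<open>Some terminal remains after deleting \<open>l\<close>, since
        \<open>R\<close> is nonempty and \<open>l\<close> is not in it.\<close>
      using l T assms(4) mg by (intro connected_delete_leaf) auto
    moreover have "multigraph (delete_vertex T l)"
      using mg by (simp add: multigraph_def delete_vertex_def induced_def)
    ultimately have "?P (delete_vertex T l)"
      using T l by (auto simp: subgraph_of_def delete_vertex_def induced_def)
    from min[OF this] have "?m T \<le> ?m (delete_vertex T l)" .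
    moreover have "card (vertices (delete_vertex T l)) < card (vertices T)"
      using l mg card_Diff1_less[of "vertices T" l]
      by (auto simp: delete_vertex_def induced_def leaves_def)
    moreover have "card (edges (delete_vertex T l)) \<le> card (edges T)"
      using mg by (intro card_mono) (auto simp: delete_vertex_def induced_def)
    ultimately show False by linarith
  qed
  ultimately show ?thesis
    using T mg by (auto simp: steiner_tree_def is_tree_def)
qed

text \<open>The tree is taken inside \<open>G[Q]\<close> with each terminal outside \<open>Q\<close>
  attached by one edge, so that such a terminal cannot become inner. The condition on edges later
  yields edge-disjointness.\<close>

lemma dominating_steiner_tree:
  assumes "multigraph G" "independent_set G R" "R \<noteq> {}" and Q: "connected_dominating G R Q"
  shows "\<exists>T. steiner_tree G R T \<and> inner_vertices T \<subseteq> Q \<and>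
    (\<forall>e\<in>edges T. ends G e \<inter> Q \<noteq> {} \<and> ends G e \<subseteq> Q \<union> R)"
proof -
  have Q': "Q \<subseteq> vertices G" "connected_graph (induced G Q)" "Q \<noteq> {}"
    "\<And>r. r \<in> R - Q \<Longrightarrow> \<exists>q\<in>Q. \<exists>e\<in>edges G. ends G e = {r, q}"
    using Q by (auto simp: connected_dominating_def adjacent_def connected_graph_def induced_def)
  have R: "R \<subseteq> vertices G" using assms(2) by (auto simp: independent_set_def)
  obtain q g where g: "\<And>r. r \<in> R - Q \<Longrightarrow> q r \<in> Q \<and> g r \<in> edges G \<and> ends G (g r) = {r, q r}"
    using Q'(4) by metis
  \<comment> \<open>\<open>g r\<close> is the one chosen edge attaching \<open>r\<close> to its
    neighbour \<open>q r\<close> in \<open>Q\<close>.\<close>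
  define H where "H = \<lparr>vertices = Q \<union> R,
    edges = {e \<in> edges G. ends G e \<subseteq> Q} \<union> g ` (R - Q), ends = ends G\<rparr>"
  have H: "vertices H = Q \<union> R" "edges H = {e \<in> edges G. ends G e \<subseteq> Q} \<union> g ` (R - Q)"
    "ends H = ends G"
    by (auto simp: H_def)
  have sub: "edges H \<subseteq> edges G" using H(2) g by auto
  have edge: "ends G e \<inter> Q \<noteq> {} \<and> ends G e \<subseteq> Q \<union> R" if e: "e \<in> edges H" for e
    using e unfolding H(2)
  proof
    assume e: "e \<in> {e \<in> edges G. ends G e \<subseteq> Q}"
    then have "ends G e \<noteq> {}" using assms(1) by (auto simp: multigraph_def)
    with e show ?thesis by auto
  next
    assume "e \<in> g ` (R - Q)"
    then show ?thesis using g by auto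
  qed
  have mH: "multigraph H"
    unfolding multigraph_def
  proof (intro conjI ballI)
    show "finite (vertices H)"
      using assms(1) Q'(1) R H(1) finite_subset[of "Q \<union> R" "vertices G"]
      by (auto simp: multigraph_def)
    show "finite (edges H)"
      using assms(1) sub finite_subset by (auto simp: multigraph_def)
    show "ends H e \<subseteq> vertices H" "card (ends H e) = 2" if "e \<in> edges H" for e
      using edge[OF that] H(1,3) assms(1) sub that by (auto simp: multigraph_def)
  qed
  have QQ: "(a, b) \<in> (linked H (Q \<union> R))\<^sup>*" if "a \<in> Q" "b \<in> Q" for a b
  proof -
    have "(a, b) \<in> (linked (induced G Q) Q)\<^sup>*"
      using Q'(2) that by (auto simp: connected_graph_iff_linked induced_def)
    moreover have "linked (induced G Q) Q \<subseteq> linked H (Q \<union> R)"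
      by (auto simp: linked_def induced_def adjacent_def H)
    ultimately show ?thesis using rtrancl_mono by blast
  qed
  have toQ: "\<exists>b\<in>Q. (a, b) \<in> (linked H (Q \<union> R))\<^sup>*" if a: "a \<in> Q \<union> R" for a
  proof (cases "a \<in> Q")
    case False
    then have "a \<in> R - Q" using a by auto
    with g[OF this] have "(a, q a) \<in> linked H (Q \<union> R)"
      unfolding linked_def adjacent_def H by auto
    then show ?thesis using g[OF \<open>a \<in> R - Q\<close>] by blast
  qed auto
  have "(a, b) \<in> (linked H (Q \<union> R))\<^sup>*" if "a \<in> Q \<union> R" "b \<in> Q \<union> R" for a b
    using toQ[OF that(1)] toQ[OF that(2)] QQ by (meson linked_rtrancl_sym rtrancl_trans)
  then have "connected_graph H"
    using Q'(3) H by (auto simp: connected_graph_iff_linked)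
  then obtain T where T: "steiner_tree H R T"
    using steiner_tree_exists[OF mH, of R] assms(3) H by auto
  have TH: "subgraph_of T H" using T by (auto simp: steiner_tree_def)
  have HG: "subgraph_of H G"
    using mH sub H Q'(1) R by (auto simp: subgraph_of_def)
  have "degree H r \<le> 1" if r: "r \<in> R - Q" for r
  proof -
    \<comment> \<open>Edges of \<open>G[Q]\<close> miss \<open>r\<close>, and another
      \<open>g r'\<close> has as ends \<open>r'\<close> and a vertex of \<open>Q\<close>, neither
      equal to \<open>r\<close>.\<close>
    have "{e \<in> edges H. r \<in> ends H e} \<subseteq> {g r}"
      using g r by (auto simp: H)
    then have "card {e \<in> edges H. r \<in> ends H e} \<le> card {g r}" by (intro card_mono) auto
    then show ?thesis by (simp add: degree_def)
  qed
  then have "degree T r \<le> 1" if "r \<in> R - Q" for r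
    using subgraph_degree_le[OF TH mH, of r] that order_trans by blast
  then have "inner_vertices T \<subseteq> Q"
    using TH H by (fastforce simp: inner_vertices_def subgraph_of_def)
  moreover have "steiner_tree G R T"
    using T subgraph_of_trans[OF TH HG] by (auto simp: steiner_tree_def)
  moreover have "edges T \<subseteq> edges H" using TH by (simp add: subgraph_of_def)
  ultimately show ?thesis using edge by blast
qed

section \<open>The equivalence, with the trees numbered by \<open>{1..k}\<close>\<close>

theorem theorem3p15:
  fixes G :: "('v, 'e) mgraph" and R :: "'v set" and k :: nat
  assumes "multigraph G" and "connected_graph G"
    and "independent_set G R" and "card R \<ge> 2"
  shows "(\<exists>\<T>. finite \<T> \<and> card \<T> = k \<and> CIST G R \<T>) \<longleftrightarrow>
    (\<exists>V :: nat \<Rightarrow> 'v set. disjoint_family_on V {1..k} \<and>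
       (\<forall>i\<in>{1..k}. connected_dominating G R (V i)))"
proof
  assume "\<exists>\<T>. finite \<T> \<and> card \<T> = k \<and> CIST G R \<T>"
  then obtain \<T> where \<T>: "finite \<T>" "card \<T> = k" "CIST G R \<T>" by blast
  then obtain f where f: "bij_betw f {1..k} \<T>"
    using finite_same_card_bij[of "{1..k}" \<T>] by auto
  have "disjoint_family_on (\<lambda>i. inner_vertices (f i)) {1..k}"
    unfolding disjoint_family_on_def
  proof (intro ballI impI)
    fix i j assume "i \<in> {1..k}" "j \<in> {1..k}" "i \<noteq> j"
    then have "f i \<in> \<T>" "f j \<in> \<T>" "f i \<noteq> f j"
      using bij_betw_apply[OF f] inj_onD[OF bij_betw_imp_inj_on[OF f]] by blast+
    then show "inner_vertices (f i) \<inter> inner_vertices (f j) = {}"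
      using CIST_inner_disjoint[OF \<T>(3)] by blast
  qed
  moreover have "connected_dominating G R (inner_vertices (f i))" if "i \<in> {1..k}" for i
    using \<T>(3) bij_betw_apply[OF f that]
    by (intro steiner_tree_inner_dominating[OF assms(3,4)]) (simp add: CIST_def)
  ultimately show "\<exists>V :: nat \<Rightarrow> 'v set. disjoint_family_on V {1..k} \<and>
       (\<forall>i\<in>{1..k}. connected_dominating G R (V i))"
    by blast
next
  assume "\<exists>V :: nat \<Rightarrow> 'v set. disjoint_family_on V {1..k} \<and>
       (\<forall>i\<in>{1..k}. connected_dominating G R (V i))"
  then obtain V :: "nat \<Rightarrow> 'v set" where V: "disjoint_family_on V {1..k}"
    "\<And>i. i \<in> {1..k} \<Longrightarrow> connected_dominating G R (V i)" by blast
  have "R \<noteq> {}" using assms(4) by auto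
  then have "\<forall>i\<in>{1..k}. \<exists>T. steiner_tree G R T \<and> inner_vertices T \<subseteq> V i \<and>
    (\<forall>e\<in>edges T. ends G e \<inter> V i \<noteq> {} \<and> ends G e \<subseteq> V i \<union> R)"
    using dominating_steiner_tree[OF assms(1,3)] V(2) by blast
  then obtain f where f: "\<And>i. i \<in> {1..k} \<Longrightarrow> steiner_tree G R (f i)"
    "\<And>i. i \<in> {1..k} \<Longrightarrow> inner_vertices (f i) \<subseteq> V i"
    "\<And>i e. i \<in> {1..k} \<Longrightarrow> e \<in> edges (f i) \<Longrightarrow> ends G e \<inter> V i \<noteq> {} \<and> ends G e \<subseteq> V i \<union> R"
    by (metis (no_types, lifting))
  have disjV: "V i \<inter> V j = {}" if "i \<in> {1..k}" "j \<in> {1..k}" "i \<noteq> j" for i j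
    using V(1) that by (auto simp: disjoint_family_on_def)
  have disjE: "edges (f i) \<inter> edges (f j) = {}" if ij: "i \<in> {1..k}" "j \<in> {1..k}" "i \<noteq> j" for i j
  proof (rule ccontr)
    assume "edges (f i) \<inter> edges (f j) \<noteq> {}"
    then obtain e where e: "e \<in> edges (f i)" "e \<in> edges (f j)" by auto
    obtain a b where ab: "a \<in> ends G e" "a \<in> V i" "b \<in> ends G e" "b \<in> V j"
      using f(3)[OF ij(1) e(1)] f(3)[OF ij(2) e(2)] by blast
    \<comment> \<open>By disjointness \<open>a\<close> is not in \<open>V j\<close>, yet it lies in
      \<open>V j \<union> R\<close>, so it is a terminal; likewise \<open>b\<close>. Then
      \<open>e\<close> would join two terminals.\<close>
    then have "a \<in> R" "b \<in> R" "a \<noteq> b"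
      using f(3)[OF ij(1) e(1)] f(3)[OF ij(2) e(2)] disjV[OF ij] by blast+
    moreover have eG: "e \<in> edges G"
      using f(1)[OF ij(1)] e by (auto simp: steiner_tree_def subgraph_of_def)
    moreover have "ends G e = {a, b}"
      using multigraph_edge_other[OF assms(1) eG ab(1)] ab \<open>a \<noteq> b\<close> by blast
    ultimately show False
      using assms(3) by (auto simp: independent_set_def adjacent_def)
  qed
  have path: "path_between (f i) u (tree_path (f i) u v) v"
    if "i \<in> {1..k}" "u \<in> R" "v \<in> R" for i u v
    using f(1)[OF that(1)] that by (intro tree_path_between) (auto simp: steiner_tree_def)
  have edges_path: "set (snd (tree_path (f i) u v)) \<subseteq> edges (f i)"
    if "i \<in> {1..k}" "u \<in> R" "v \<in> R" for i u v
    using walk_edges[of "f i" "fst (tree_path (f i) u v)" "snd (tree_path (f i) u v)"]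
      path[OF that] by (simp add: path_between_def)
  \<comment> \<open>Interior vertices of a tree path are inner vertices of the tree, which lie in
    \<open>V i\<close>.\<close>
  have internal_path: "internal_vertices (tree_path (f i) u v) \<subseteq> V i"
    if i: "i \<in> {1..k}" and uv: "u \<in> R" "v \<in> R" "u \<noteq> v" for i u v
  proof -
    have "multigraph (f i)" using f(1)[OF i] by (auto simp: steiner_tree_def subgraph_of_def)
    then show ?thesis
      using path_inner[OF _ path[OF i uv(1,2)]] internal_vertices_path[OF path[OF i uv(1,2)] uv(3)]
        f(2)[OF i] by blast
  qed
  \<comment> \<open>A CIST is a set, so distinct indices must give distinct trees. A tree chosen for
    two indices would share all its edges with itself and so have none, yet it connects two distinct
    terminals.\<close>
  have inj: "inj_on f {1..k}"
  proof (rule inj_onI, rule ccontr)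
    fix i j assume ij: "i \<in> {1..k}" "j \<in> {1..k}" "f i = f j" "i \<noteq> j"
    then have "V i \<inter> V j = {}" "edges (f i) = {}" using disjV disjE[of i j] by auto
    moreover obtain u where u: "u \<in> R" using \<open>R \<noteq> {}\<close> by blast
    moreover obtain v where v: "v \<in> R" "v \<noteq> u"
      by (rule card_ge_2_other[OF assms(4)])
    moreover have "linked (f i) (vertices (f i)) = {}"
      using \<open>edges (f i) = {}\<close> by (auto simp: linked_def adjacent_def)
    moreover have "(u, v) \<in> (linked (f i) (vertices (f i)))\<^sup>*"
      using f(1)[OF ij(1)] u v(1)
      unfolding steiner_tree_def is_tree_def connected_graph_iff_linked by blast
    ultimately show False using v(2) by simp
  qed
  have "CIST G R (f ` {1..k})"
    unfolding CIST_def
  proof (intro conjI ballI impI)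
    show "steiner_tree G R T" if "T \<in> f ` {1..k}" for T using f(1) that by blast
  next
    fix u v T T'
    assume uv: "u \<in> R" "v \<in> R" "u \<noteq> v"
      and "T \<in> f ` {1..k}" "T' \<in> f ` {1..k}" "T \<noteq> T'"
    then obtain i j where ij: "i \<in> {1..k}" "j \<in> {1..k}" "i \<noteq> j" "T = f i" "T' = f j" by blast
    show "edge_disjoint (tree_path T u v) (tree_path T' u v)"
      using edges_path[OF ij(1) uv(1,2)] edges_path[OF ij(2) uv(1,2)] disjE[OF ij(1-3)] ij(4,5)
      unfolding edge_disjoint_def by blast
    show "internally_disjoint (tree_path T u v) (tree_path T' u v)"
      using internal_path[OF ij(1) uv] internal_path[OF ij(2) uv] disjV[OF ij(1-3)] ij(4,5)
      unfolding internally_disjoint_def by blast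
  qed
  moreover have "card (f ` {1..k}) = k" using card_image[OF inj] by simp
  ultimately show "\<exists>\<T>. finite \<T> \<and> card \<T> = k \<and> CIST G R \<T>" by blast
qed

end
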